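(* Let $X$ be a set with at least two elements, $f:X\to X$ a self-function, and $R=R_f$ the associated left non-degenerate solution on $X$, $R_f(x,y)=(y,f(x))$ for all $x,y\in X$. The following statements are equivalent: (a) $R_f$ is indecomposable; (b) the functional digraph $\Gamma_f$ is connected; (c) for every $x,y\in X$ there are non-negative integers $m$ and $n$ with $f^m(x)=f^n(y)$; (d) there is no non-trivial $f$-invariant partition of $X$, i.e. no partition $X=Y\sqcup Z$ with $Y,Z$ non-empty such that $f(Y)\subseteq Y$ and $f(Z)\subseteq Z$.
   Context: For a set $X$ let $\tau_X(x,y)=(y,x)$ be the flip map on $X\times X$. For a map $R:X\times X\to X\times X$ put, as maps $X^3\to X^3$, $R^{12}=R\times \mathrm{Id}_X$, $R^{23}=\mathrm{Id}_X\times R$, $R^{13}=(\mathrm{Id}_X\times\tau_X)\circ R^{12}\circ(\mathrm{Id}_X\times\tau_X)$. $R$ is called a solution on $X$ (of the set-theoretic Frobenius-Separability equation) if $R^{12}R^{23}=R^{23}R^{13}=R^{13}R^{12}$. Writing $R(x,y)=(l_x(y),r_y(x))$, $R$ is left non-degenerate if every $l_x:X\to X$ is bijective. A solution $R$ on $X$ is decomposable if there is a partition $X=Y\sqcup Z$ with $Y,Z$ non-empty, $R(Y\times Y)\subseteq Y\times Y$ and $R(Z\times Z)\subseteq Z\times Z$; it is indecomposable otherwise. The functional digraph $\Gamma_f$ has vertex set $X$ and an edge $x\to y$ precisely when $y=f(x)$ and $x\neq y$. A digraph is connected if its underlying undirected graph is connected. *)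

theory Defs
  imports "HOL-Library.FuncSet" "Graph_Theory.Digraph_Component"
begin

text \<open>
  The cube of \<open>X\<close> is \<open>X \<times> X \<times> X = X \<times> (X \<times> X)\<close>.
  Maps are total HOL functions; only their values on \<open>X\<close> (or its powers) are constrained.
\<close>

definition R12 :: "('a \<times> 'a \<Rightarrow> 'a \<times> 'a) \<Rightarrow> 'a \<times> 'a \<times> 'a \<Rightarrow> 'a \<times> 'a \<times> 'a" where
  "R12 R = (\<lambda>(x, y, z). (fst (R (x, y)), snd (R (x, y)), z))"

definition R23 :: "('a \<times> 'a \<Rightarrow> 'a \<times> 'a) \<Rightarrow> 'a \<times> 'a \<times> 'a \<Rightarrow> 'a \<times> 'a \<times> 'a" where
  "R23 R = map_prod id R"

definition R13 :: "('a \<times> 'a \<Rightarrow> 'a \<times> 'a) \<Rightarrow> 'a \<times> 'a \<times> 'a \<Rightarrow> 'a \<times> 'a \<times> 'a" where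
  "R13 R = map_prod id prod.swap \<circ> R12 R \<circ> map_prod id prod.swap"

text \<open>Solutions of the set-theoretic Frobenius-Separability equation.\<close>

definition fs_solution :: "'a set \<Rightarrow> ('a \<times> 'a \<Rightarrow> 'a \<times> 'a) \<Rightarrow> bool" where
  "fs_solution X R \<longleftrightarrow>
     R \<in> X \<times> X \<rightarrow> X \<times> X \<and>
     (\<forall>t \<in> X \<times> X \<times> X.
        (R12 R \<circ> R23 R) t = (R23 R \<circ> R13 R) t \<and>
        (R23 R \<circ> R13 R) t = (R13 R \<circ> R12 R) t)"

definition left_nondegenerate :: "'a set \<Rightarrow> ('a \<times> 'a \<Rightarrow> 'a \<times> 'a) \<Rightarrow> bool" where
  "left_nondegenerate X R \<longleftrightarrow> (\<forall>x \<in> X. bij_betw (\<lambda>y. fst (R (x, y))) X X)"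

definition nontrivial_bipartition :: "'a set \<Rightarrow> 'a set \<Rightarrow> 'a set \<Rightarrow> bool" where
  "nontrivial_bipartition X Y Z \<longleftrightarrow> X = Y \<union> Z \<and> Y \<inter> Z = {} \<and> Y \<noteq> {} \<and> Z \<noteq> {}"

text \<open>Decomposability and indecomposability are properties of solutions only.\<close>

definition decomposable :: "'a set \<Rightarrow> ('a \<times> 'a \<Rightarrow> 'a \<times> 'a) \<Rightarrow> bool" where
  "decomposable X R \<longleftrightarrow>
     fs_solution X R \<and>
     (\<exists>Y Z. nontrivial_bipartition X Y Z \<and>
        R ` (Y \<times> Y) \<subseteq> Y \<times> Y \<and> R ` (Z \<times> Z) \<subseteq> Z \<times> Z)"

definition indecomposable :: "'a set \<Rightarrow> ('a \<times> 'a \<Rightarrow> 'a \<times> 'a) \<Rightarrow> bool" where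
  "indecomposable X R \<longleftrightarrow> fs_solution X R \<and> \<not> decomposable X R"

definition R_of :: "('a \<Rightarrow> 'a) \<Rightarrow> 'a \<times> 'a \<Rightarrow> 'a \<times> 'a" where
  "R_of f = (\<lambda>(x, y). (y, f x))"

text \<open>The set \<open>X\<close> may be infinite, so this is only a \<^locale>\<open>wf_digraph\<close> in general.\<close>

definition functional_digraph :: "'a set \<Rightarrow> ('a \<Rightarrow> 'a) \<Rightarrow> ('a, 'a \<times> 'a) pre_digraph" where
  "functional_digraph X f =
     \<lparr> verts = X, arcs = {(x, y) \<in> X \<times> X. y = f x \<and> x \<noteq> y}, tail = fst, head = snd \<rparr>"

lemma wf_digraph_functional_digraph: "wf_digraph (functional_digraph X f)"
  by unfold_locales (auto simp: functional_digraph_def)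

lemma fs_solution_R_of:
  assumes "f \<in> X \<rightarrow> X"
  shows "fs_solution X (R_of f)"
  using assms by (auto simp: fs_solution_def R_of_def R12_def R23_def R13_def)

lemma left_nondegenerate_R_of: "left_nondegenerate X (R_of f)"
  by (simp add: left_nondegenerate_def R_of_def bij_betw_def)

end

theory Submission
  imports Defs
begin

text \<open>
  Everything rests on one relation: two points are related when their forward orbits meet.
  It is an equivalence relation, transitivity being the only point with content: a common point
  of two orbits can be pushed forward along \<open>f\<close>, and two meetings on the orbit of the middle
  point can thereby be moved to the same place. Since \<open>f x\<close> lies on the orbit of \<open>x\<close>, the
  relation is the equivalence relation generated by the pairs \<open>(x, f x)\<close>. The four conditions
  are four ways of saying that it has a single class on \<open>X\<close>.

  \<^item> An arc of the functional digraph is a pair \<open>(x, f x)\<close>, and the loops left out do not affect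
    undirected reachability; so the connected components are the classes
    (\<open>connected_functional_digraph_iff\<close>).
  \<^item> A part of an invariant bipartition contains the orbit of each of its points, so orbits
    starting in different parts are disjoint. Conversely, a class and its complement form an
    invariant bipartition as soon as there is a second class (\<open>orbits_meet_iff_no_bipartition\<close>).
  \<^item> In \<open>(x, y) \<mapsto> (y, f x)\<close> the first output is one of the inputs, so this map
    preserves \<open>Y \<times> Y\<close> exactly when \<open>f\<close> preserves \<open>Y\<close>; hence decomposing the solution
    is the same as splitting \<open>X\<close> into invariant parts (\<open>indecomposable_R_of_iff\<close>).
\<close>

definition orbits_meet :: "('a \<Rightarrow> 'a) \<Rightarrow> 'a \<Rightarrow> 'a \<Rightarrow> bool" where
  "orbits_meet f x y \<longleftrightarrow> (\<exists>m n :: nat. (f ^^ m) x = (f ^^ n) y)"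

lemma orbits_meet_refl: "orbits_meet f x x"
  by (auto simp: orbits_meet_def)

lemma orbits_meet_sym: "orbits_meet f x y \<Longrightarrow> orbits_meet f y x"
  unfolding orbits_meet_def by metis

lemma orbits_meet_trans:
  assumes "orbits_meet f x y" and "orbits_meet f y z"
  shows "orbits_meet f x z"
proof -
  from assms obtain m n p q where xy: "(f ^^ m) x = (f ^^ n) y" and yz: "(f ^^ p) y = (f ^^ q) z"
    by (auto simp: orbits_meet_def)
  \<comment> \<open>Both meetings are pushed forward to the point \<open>(f ^^ (p + n)) y\<close>.\<close>
  have "(f ^^ (p + m)) x = (f ^^ (p + n)) y"
    by (simp add: funpow_add xy)
  also have "\<dots> = (f ^^ (n + p)) y"
    by (simp add: add.commute)
  also have "\<dots> = (f ^^ (n + q)) z"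
    by (simp add: funpow_add yz)
  finally show ?thesis
    by (auto simp: orbits_meet_def)
qed

lemma orbits_meet_step: "orbits_meet f x (f x)"
  unfolding orbits_meet_def by (rule exI[of _ 1], rule exI[of _ 0]) simp

lemma funpow_in_invariant_set:
  assumes "f ` Y \<subseteq> Y" and "x \<in> Y"
  shows "(f ^^ n) x \<in> Y"
  using assms by (induction n) auto

lemma arcs_ends_functional_digraph:
  "arcs_ends (functional_digraph X f) = {(x, y) \<in> X \<times> X. y = f x \<and> x \<noteq> y}"
  by (auto simp: arcs_ends_conv functional_digraph_def)

lemma connected_functional_digraph_iff:
  assumes self_map: "f \<in> X \<rightarrow> X" and nonempty: "X \<noteq> {}"
  shows "Digraph_Component.connected (functional_digraph X f) \<longleftrightarrow>
    (\<forall>x \<in> X. \<forall>y \<in> X. orbits_meet f x y)"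
proof -
  let ?E = "(arcs_ends (functional_digraph X f))\<^sup>s"
  have verts: "verts (functional_digraph X f) = X"
    by (simp add: functional_digraph_def)
  have edge: "(x, y) \<in> ?E \<longleftrightarrow> x \<in> X \<and> y \<in> X \<and> x \<noteq> y \<and> (y = f x \<or> x = f y)" for x y
    by (auto simp: arcs_ends_functional_digraph symcl_def)
  have meet_if_reachable: "orbits_meet f x y" if "(x, y) \<in> rtrancl_on X ?E" for x y
    using that
  proof (induction rule: rtrancl_on_induct)
    case base
    show ?case by (rule orbits_meet_refl)
  next
    case (step y z)
    have "orbits_meet f y z"
      using step.hyps edge[of y z] by (auto intro: orbits_meet_step orbits_meet_sym)
    with step.IH show ?case by (rule orbits_meet_trans)
  qed
  have reach_orbit: "(x, (f ^^ n) x) \<in> rtrancl_on X ?E" if "x \<in> X" for x n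
  proof (induction n)
    case 0
    show ?case using that by simp
  next
    case (Suc n)
    let ?y = "(f ^^ n) x"
    have y: "?y \<in> X" and fy: "f ?y \<in> X"
      using Suc.IH self_map by (auto dest: in_rtrancl_on_in_F)
    show ?case
    proof (cases "f ?y = ?y")
      \<comment> \<open>At a fixed point the digraph has no arc, but the orbit does not move either.\<close>
      case True
      with Suc.IH show ?thesis by simp
    next
      case False
      with y fy have "(?y, f ?y) \<in> ?E" by (auto simp: edge)
      with Suc.IH fy show ?thesis by (auto intro: rtrancl_on_into_rtrancl_on)
    qed
  qed
  have sym: "sym (rtrancl_on X ?E)"
    by (rule rtrancl_on_sym) (auto simp: sym_def edge)
  have reachable_if_meet: "(x, y) \<in> rtrancl_on X ?E"
    if "x \<in> X" "y \<in> X" "orbits_meet f x y" for x y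
  proof -
    from that(3) obtain m n where "(f ^^ m) x = (f ^^ n) y" by (auto simp: orbits_meet_def)
    with reach_orbit[OF that(1), of m] reach_orbit[OF that(2), of n] show ?thesis
      by (metis rtrancl_on_trans symD[OF sym])
  qed
  show ?thesis
    unfolding connected_conv verts using nonempty meet_if_reachable reachable_if_meet by blast
qed

lemma orbits_meet_iff_no_bipartition:
  assumes self_map: "f \<in> X \<rightarrow> X"
  shows "(\<forall>x \<in> X. \<forall>y \<in> X. orbits_meet f x y) \<longleftrightarrow>
    \<not> (\<exists>Y Z. nontrivial_bipartition X Y Z \<and> f ` Y \<subseteq> Y \<and> f ` Z \<subseteq> Z)"
proof (intro iffI notI ballI)
  assume meet: "\<forall>x \<in> X. \<forall>y \<in> X. orbits_meet f x y"
    and "\<exists>Y Z. nontrivial_bipartition X Y Z \<and> f ` Y \<subseteq> Y \<and> f ` Z \<subseteq> Z"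
  then obtain Y Z y z where YZ: "X = Y \<union> Z" "Y \<inter> Z = {}" "f ` Y \<subseteq> Y" "f ` Z \<subseteq> Z"
    and yz: "y \<in> Y" "z \<in> Z"
    unfolding nontrivial_bipartition_def by blast
  with meet have "orbits_meet f y z" by blast
  then obtain m n where "(f ^^ m) y = (f ^^ n) z" by (auto simp: orbits_meet_def)
  with YZ yz funpow_in_invariant_set[of f Y y m] funpow_in_invariant_set[of f Z z n]
  show False by auto
next
  fix x y
  assume indec: "\<not> (\<exists>Y Z. nontrivial_bipartition X Y Z \<and> f ` Y \<subseteq> Y \<and> f ` Z \<subseteq> Z)"
    and x: "x \<in> X" and y: "y \<in> X"
  let ?Y = "{z \<in> X. orbits_meet f x z}" and ?Z = "{z \<in> X. \<not> orbits_meet f x z}"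
  have shift: "orbits_meet f x (f z) \<longleftrightarrow> orbits_meet f x z" for z
    using orbits_meet_step orbits_meet_sym orbits_meet_trans by metis
  show "orbits_meet f x y"
  proof (rule ccontr)
    assume "\<not> orbits_meet f x y"
    with x y orbits_meet_refl[of f x] have "nontrivial_bipartition X ?Y ?Z"
      by (auto simp: nontrivial_bipartition_def)
    moreover have "f ` ?Y \<subseteq> ?Y" and "f ` ?Z \<subseteq> ?Z"
      using self_map by (auto simp: shift)
    ultimately show False using indec by blast
  qed
qed

text \<open>
  For the forward direction the diagonal suffices: \<open>(x, x)\<close> is sent to \<open>(x, f x)\<close>.
\<close>

lemma R_of_image_subset_iff: "R_of f ` (Y \<times> Y) \<subseteq> Y \<times> Y \<longleftrightarrow> f ` Y \<subseteq> Y"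
  by (auto simp: R_of_def)

lemma indecomposable_R_of_iff:
  assumes "f \<in> X \<rightarrow> X"
  shows "indecomposable X (R_of f) \<longleftrightarrow>
    \<not> (\<exists>Y Z. nontrivial_bipartition X Y Z \<and> f ` Y \<subseteq> Y \<and> f ` Z \<subseteq> Z)"
  using fs_solution_R_of[OF assms]
  by (simp add: indecomposable_def decomposable_def R_of_image_subset_iff)

theorem theorem5:
  fixes X :: "'a set" and f :: "'a \<Rightarrow> 'a"
  assumes two_elements: "\<exists>x \<in> X. \<exists>y \<in> X. x \<noteq> y"
    and self_map: "f \<in> X \<rightarrow> X"
  shows "(indecomposable X (R_of f) \<longleftrightarrow>
            Digraph_Component.connected (functional_digraph X f)) \<and>
         (Digraph_Component.connected (functional_digraph X f) \<longleftrightarrow>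
            (\<forall>x \<in> X. \<forall>y \<in> X. \<exists>m n :: nat. (f ^^ m) x = (f ^^ n) y)) \<and>
         ((\<forall>x \<in> X. \<forall>y \<in> X. \<exists>m n :: nat. (f ^^ m) x = (f ^^ n) y) \<longleftrightarrow>
            \<not> (\<exists>Y Z. nontrivial_bipartition X Y Z \<and> f ` Y \<subseteq> Y \<and> f ` Z \<subseteq> Z))"
proof -
  have "X \<noteq> {}" using two_elements by blast
  from connected_functional_digraph_iff[OF self_map this]
    orbits_meet_iff_no_bipartition[OF self_map] indecomposable_R_of_iff[OF self_map]
  show ?thesis unfolding orbits_meet_def by argo
qed

end
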